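(* For any $q>0$ there exists some $n_0>0$ such that $\chi_\mu(Q_n)>q$ for all integers $n\geq n_0$. On the other hand, $\chi_\mu(Q_n)=O(\log\log n)$ as $n\to\infty$, i.e., there exist constants $C>0$ and $n_1$ such that $\chi_\mu(Q_n)\leq C\log\log n$ for all integers $n\geq n_1$.
   Context: For a positive integer $n$, write $[n]=\{1,\dots,n\}$. The $n$-dimensional hypercube $Q_n$ is the graph on the vertex set $2^{[n]}$ (all subsets of $[n]$), where $A,B\in 2^{[n]}$ are adjacent if and only if $|A\Delta B|=1$, with $A\Delta B=(A\setminus B)\cup(B\setminus A)$. Let $G$ be a simple graph and $M\subseteq V(G)$. Two vertices $u,v\in V(G)$ are $M$-visible if there exists a shortest $u,v$-path in $G$ that contains no vertices from $M\setminus\{u,v\}$. The set $M$ is a mutual-visibility set if any two vertices $u,v\in M$ are $M$-visible. The chromatic mutual-visibility number $\chi_\mu(G)$ is the smallest number of colors in a vertex-coloring of $G$ (not required to be proper) such that each color class is a mutual-visibility set in $G$; equivalently, the smallest integer $k$ such that $V(G)$ can be partitioned into $k$ mutual-visibility sets. *)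

theory Defs
  imports Complex_Main "Graph_Theory.Graph_Theory"
begin

text \<open>
  A finite simple graph is a \<^locale>\<open>pair_graph\<close>: a symmetric loop-free digraph without
  parallel arcs, each edge being represented by its two orientations. Paths are lists of vertices.
\<close>

definition shortest_path :: "'a pair_pre_digraph \<Rightarrow> 'a \<Rightarrow> 'a list \<Rightarrow> 'a \<Rightarrow> bool" where
  "shortest_path G u p v \<longleftrightarrow>
     vpath p (with_proj G) \<and> hd p = u \<and> last p = v \<and>
     (\<forall>q. vpath q (with_proj G) \<and> hd q = u \<and> last q = v \<longrightarrow> vwalk_length p \<le> vwalk_length q)"

definition visible :: "'a pair_pre_digraph \<Rightarrow> 'a set \<Rightarrow> 'a \<Rightarrow> 'a \<Rightarrow> bool" where
  "visible G M u v \<longleftrightarrow> (\<exists>p. shortest_path G u p v \<and> set p \<inter> (M - {u, v}) = {})"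

definition mutual_visibility_set :: "'a pair_pre_digraph \<Rightarrow> 'a set \<Rightarrow> bool" where
  "mutual_visibility_set G M \<longleftrightarrow> M \<subseteq> pverts G \<and> (\<forall>u\<in>M. \<forall>v\<in>M. visible G M u v)"

definition mutual_visibility_coloring :: "'a pair_pre_digraph \<Rightarrow> nat \<Rightarrow> ('a \<Rightarrow> nat) \<Rightarrow> bool" where
  "mutual_visibility_coloring G k c \<longleftrightarrow>
     (\<forall>v\<in>pverts G. c v < k) \<and>
     (\<forall>i<k. mutual_visibility_set G {v \<in> pverts G. c v = i})"

text \<open>
  The minimum exists for every finite graph; see \<open>ex_mutual_visibility_coloring\<close> below.
\<close>

definition chromatic_mutual_visibility_number :: "'a pair_pre_digraph \<Rightarrow> nat" where
  "chromatic_mutual_visibility_number G = (LEAST k. \<exists>c. mutual_visibility_coloring G k c)"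

definition hypercube :: "nat \<Rightarrow> nat set pair_pre_digraph" where
  "hypercube n =
     \<lparr> pverts = Pow {1..n},
       parcs = {(A, B). A \<in> Pow {1..n} \<and> B \<in> Pow {1..n} \<and> card (sym_diff A B) = 1} \<rparr>"

lemma pair_graph_hypercube: "pair_graph (hypercube n)"
proof -
  have "finite (parcs (hypercube n))"
    by (rule finite_subset[of _ "Pow {1..n} \<times> Pow {1..n}"]) (auto simp: hypercube_def)
  then show ?thesis
    by unfold_locales
      (auto simp: hypercube_def symmetric_def sym_def with_proj_simps Un_commute)
qed

lemma visible_refl: "u \<in> pverts G \<Longrightarrow> visible G M u u"
  unfolding visible_def shortest_path_def
  by (rule exI[of _ "[u]"]) (auto simp: vpath_def vwalk_def)

lemma ex_mutual_visibility_coloring: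
  assumes "finite (pverts G)"
  shows "\<exists>k c. mutual_visibility_coloring G k c"
proof -
  obtain c where c: "bij_betw c (pverts G) {0..<card (pverts G)}"
    using ex_bij_betw_finite_nat[OF assms] by blast
  have "mutual_visibility_coloring G (card (pverts G)) c"
    unfolding mutual_visibility_coloring_def mutual_visibility_set_def
  proof (intro conjI ballI allI impI)
    fix v assume "v \<in> pverts G"
    then show "c v < card (pverts G)"
      using c by (auto simp: bij_betw_def)
  next
    fix i u v
    assume "u \<in> {v \<in> pverts G. c v = i}" "v \<in> {v \<in> pverts G. c v = i}"
    moreover from this have "u = v"
      using c by (auto simp: bij_betw_def inj_on_def)
    ultimately show "visible G {v \<in> pverts G. c v = i} u v"
      by (simp add: visible_refl)
  qed auto
  then show ?thesis by blast
qed

end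

theory Submission
  imports
    Defs
    "HOL-Library.Ramsey"
    "HOL-Library.FuncSet"
    "HOL-Computational_Algebra.Polynomial"
    "HOL-Real_Asymp.Real_Asymp"
begin

text \<open>
  Lower bound: by Ramsey's theorem there is a set \<open>S\<close> of \<open>2q\<close> coordinates on whose subsets the colour
  depends only on the size. Three of the \<open>2q + 1\<close> sizes share a colour, and a set of the smallest
  size inside a set of the largest size cannot see it, since every shortest path is monotone and
  crosses the middle level.

  Upper bound: put \<open>r = k + 1\<close> of order \<open>log log n\<close> and colour \<open>A\<close> by \<open>(|A| mod r, f A)\<close> for a two-colouring
  \<open>f\<close> such that for every \<open>X\<close> and every \<open>D\<close> disjoint from \<open>X\<close> with \<open>|D| = 2k + 1\<close>, both values of \<open>f\<close>
  occur on the sets \<open>X \<union> R\<close>, \<open>R \<subseteq> D\<close>, \<open>|R| = k\<close>. A shortest path between two sets of the same colour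
  first trades elements on levels next to a level of that colour, and then climbs, using the
  property of \<open>f\<close> to dodge the colour class on each of the levels it has to cross.
  Such an \<open>f\<close> is \<open>A \<mapsto> g (v A)\<close>, where \<open>v A\<close> is the vector of the first \<open>2k + 1\<close> power sums of \<open>A\<close>:
  \<open>v\<close> separates the sets \<open>X \<union> R\<close> but takes so few values that only \<open>n ^ O(k^2)\<close> traces of size
  at least \<open>2 ^ k\<close> have to be non-monochromatic, and a union bound over all \<open>g\<close> suffices.
\<close>

section \<open>Shortest paths in the hypercube\<close>

abbreviation cube_adj :: "'a set \<Rightarrow> 'a set \<Rightarrow> bool" where
  "cube_adj A B \<equiv> card (sym_diff A B) = 1"

lemma vwalk_iff_successively:
  "vwalk p (with_proj G) \<longleftrightarrow>
     p \<noteq> [] \<and> set p \<subseteq> pverts G \<and> successively (\<lambda>u v. (u, v) \<in> parcs G) p"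
proof -
  have "set (vwalk_arcs p) \<subseteq> parcs G \<longleftrightarrow> successively (\<lambda>u v. (u, v) \<in> parcs G) p"
    by (induction p rule: vwalk_arcs.induct) auto
  then show ?thesis
    by (auto simp: vwalk_def)
qed

lemma vwalk_hypercube_iff:
  "vwalk p (with_proj (hypercube n)) \<longleftrightarrow>
     p \<noteq> [] \<and> set p \<subseteq> Pow {1..n} \<and> successively cube_adj p"
proof -
  have "successively (\<lambda>A B. (A, B) \<in> parcs (hypercube n)) p \<longleftrightarrow> successively cube_adj p"
    if "set p \<subseteq> Pow {1..n}"
    using that by (intro successively_cong) (auto simp: hypercube_def)
  then show ?thesis
    unfolding vwalk_iff_successively by (auto simp: hypercube_def)
qed

text \<open>Triangle inequality for the Hamming distance, one edge at a time.
  \<open>length p\<close> counts vertices, one more than edges, hence the strict inequality.\<close>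

lemma card_sym_diff_le_walk_length:
  assumes "successively cube_adj p" "p \<noteq> []" "\<forall>A\<in>set p. finite A"
  shows "card (sym_diff (hd p) (last p)) < length p"
  using assms
proof (induction p)
  case (Cons A p)
  show ?case
  proof (cases "p = []")
    case False
    let ?B = "last p"
    have IH: "card (sym_diff (hd p) ?B) < length p" and adj: "cube_adj A (hd p)"
      using Cons False by (auto simp: successively_Cons)
    have fin: "finite A" "finite (hd p)" "finite ?B"
      using Cons.prems False by auto
    have "card (sym_diff A ?B) \<le> card (sym_diff A (hd p) \<union> sym_diff (hd p) ?B)"
      by (rule card_mono) (use fin in auto)
    also have "\<dots> \<le> card (sym_diff A (hd p)) + card (sym_diff (hd p) ?B)"
      by (rule card_Un_le)
    finally show ?thesis
      using IH adj False by simp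
  qed simp
qed simp

text \<open>Only \<open>tl p\<close> has to avoid \<open>M\<close>: the start is unconstrained, so
  paths can be built backwards from \<open>B\<close>, and an old start is checked when a vertex is
  prepended to it. Distinctness follows from the length.\<close>

definition geodesic_avoiding :: "nat \<Rightarrow> nat set set \<Rightarrow> nat set \<Rightarrow> nat set \<Rightarrow> bool" where
  "geodesic_avoiding n M A B \<longleftrightarrow>
     (\<exists>p. p \<noteq> [] \<and> hd p = A \<and> last p = B \<and> set p \<subseteq> Pow {1..n} \<and> successively cube_adj p \<and>
          length p = Suc (card (sym_diff A B)) \<and> set (tl p) \<inter> (M - {B}) = {})"

lemma geodesic_avoiding_refl: "A \<subseteq> {1..n} \<Longrightarrow> geodesic_avoiding n M A A"
  unfolding geodesic_avoiding_def by (rule exI[of _ "[A]"]) simp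

lemma geodesic_avoiding_step:
  assumes "A \<subseteq> {1..n}" "cube_adj A A'" "card (sym_diff A B) = Suc (card (sym_diff A' B))"
    and "A' = B \<or> A' \<notin> M" "geodesic_avoiding n M A' B"
  shows "geodesic_avoiding n M A B"
proof -
  obtain p where p: "p \<noteq> []" "hd p = A'" "last p = B" "set p \<subseteq> Pow {1..n}" "successively cube_adj p"
    "length p = Suc (card (sym_diff A' B))" "set (tl p) \<inter> (M - {B}) = {}"
    using assms(5) unfolding geodesic_avoiding_def by (elim exE conjE) (rule that)
  have "set p = insert A' (set (tl p))"
    using p(1,2) by (cases p) auto
  then have "set p \<inter> (M - {B}) = {}"
    using p(7) assms(4) by auto
  moreover have "successively cube_adj (A # p)"
    using p(2,5) assms(2) by (simp add: successively_Cons)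
  moreover have "length (A # p) = Suc (card (sym_diff A B))"
    unfolding assms(3) using p(6) by simp
  ultimately show ?thesis
    unfolding geodesic_avoiding_def using p(1,3,4) assms(1)
    by (intro exI[of _ "A # p"]) simp
qed

lemma finite_cube_vertex: "A \<subseteq> {1..n::nat} \<Longrightarrow> finite A"
  by (erule finite_subset) simp

lemma geodesic_avoiding_insert:
  assumes "A \<subseteq> {1..n}" "B \<subseteq> {1..n}" "x \<in> B - A"
    and "insert x A = B \<or> insert x A \<notin> M" "geodesic_avoiding n M (insert x A) B"
  shows "geodesic_avoiding n M A B"
proof (rule geodesic_avoiding_step[OF assms(1) _ _ assms(4,5)])
  have "sym_diff A (insert x A) = {x}"
    using assms(3) by auto
  then show "cube_adj A (insert x A)"
    by simp
  have "sym_diff A B = insert x (sym_diff (insert x A) B)"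
    using assms(3) by auto
  moreover have "finite A" "finite B"
    using assms(1,2) finite_cube_vertex by simp_all
  ultimately show "card (sym_diff A B) = Suc (card (sym_diff (insert x A) B))"
    using assms(3) by simp
qed

lemma geodesic_avoiding_remove:
  assumes "A \<subseteq> {1..n}" "B \<subseteq> {1..n}" "y \<in> A - B"
    and "A - {y} = B \<or> A - {y} \<notin> M" "geodesic_avoiding n M (A - {y}) B"
  shows "geodesic_avoiding n M A B"
proof (rule geodesic_avoiding_step[OF assms(1) _ _ assms(4,5)])
  have "sym_diff A (A - {y}) = {y}"
    using assms(3) by auto
  then show "cube_adj A (A - {y})"
    by simp
  have "sym_diff A B = insert y (sym_diff (A - {y}) B)"
    using assms(3) by auto
  moreover have "finite A" "finite B"
    using assms(1,2) finite_cube_vertex by simp_all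
  ultimately show "card (sym_diff A B) = Suc (card (sym_diff (A - {y}) B))"
    using assms(3) by simp
qed

text \<open>Insert the elements of \<open>C - A\<close> one at a time in any order: every set met
  lies strictly above \<open>A\<close> and inside \<open>C\<close>.\<close>

lemma geodesic_avoiding_climb:
  assumes "A \<subseteq> C" "C \<subseteq> B" "B \<subseteq> {1..n}"
    and "\<And>X. A \<subset> X \<Longrightarrow> X \<subseteq> C \<Longrightarrow> X = B \<or> X \<notin> M"
    and "geodesic_avoiding n M C B"
  shows "geodesic_avoiding n M A B"
proof -
  have "finite (C - A)"
    using assms(2,3) finite_subset[of C "{1..n}"] by auto
  then show ?thesis
    using assms
  proof (induction "C - A" arbitrary: A rule: finite_induct)
    case empty
    then show ?case
      by (metis Diff_eq_empty_iff subset_antisym)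
  next
    case (insert x F)
    have x: "x \<in> C" "x \<notin> A" "F = C - insert x A"
      using insert.hyps by auto
    have "geodesic_avoiding n M (insert x A) B"
    proof (rule insert.hyps(3)[OF x(3)])
      show "insert x A \<subseteq> C" "C \<subseteq> B" "B \<subseteq> {1..n}" "geodesic_avoiding n M C B"
        using x insert.prems by auto
      show "X = B \<or> X \<notin> M" if "insert x A \<subset> X" "X \<subseteq> C" for X
        using insert.prems(4)[of X] that x by blast
    qed
    moreover have "insert x A = B \<or> insert x A \<notin> M"
      using x insert.prems(1) insert.prems(4)[of "insert x A"] by blast
    ultimately show ?case
      using x insert.prems(2,3) \<open>A \<subseteq> C\<close>
      by (intro geodesic_avoiding_insert[of A n B x]) auto
  qed
qed

text \<open>Removing \<open>A - B\<close> first and then climbing realises the Hamming distance;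
  this is the competitor that bounds the length of a shortest path.\<close>

lemma geodesic_avoiding_empty:
  assumes "A \<subseteq> {1..n}" "B \<subseteq> {1..n}"
  shows "geodesic_avoiding n {} A B"
  using assms(1)
proof (induction "card (A - B)" arbitrary: A)
  case 0
  then have "A \<subseteq> B"
    using finite_cube_vertex[of A n] by auto
  then show ?case
    by (rule geodesic_avoiding_climb[where C = B])
      (use assms(2) geodesic_avoiding_refl in auto)
next
  case (Suc d)
  then obtain y where y: "y \<in> A - B"
    by (metis card.empty equals0I nat.distinct(1))
  have "finite A"
    using Suc.prems finite_cube_vertex by simp
  moreover have "A - {y} - B = (A - B) - {y}"
    by auto
  ultimately have "d = card (A - {y} - B)"
    using Suc.hyps(2) y by simp
  then show ?case
    using Suc.hyps(1)[of "A - {y}"] Suc.prems assms(2) y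
    by (intro geodesic_avoiding_remove[OF _ assms(2) y]) auto
qed

text \<open>Cutting out the loop between two visits of a vertex would leave a walk shorter than the
  Hamming distance.\<close>

lemma distinct_walk_of_dist:
  assumes "successively cube_adj p" "p \<noteq> []" "\<forall>A\<in>set p. finite A"
    and "length p = Suc (card (sym_diff (hd p) (last p)))"
  shows "distinct p"
proof (rule ccontr)
  assume "\<not> distinct p"
  then obtain xs y ys zs where p: "p = xs @ [y] @ ys @ [y] @ zs"
    using not_distinct_decomp by blast
  let ?q = "xs @ [y] @ zs"
  have "successively cube_adj ?q"
    using assms(1) unfolding p by (auto simp: successively_append_iff successively_Cons)
  then have "card (sym_diff (hd ?q) (last ?q)) < length ?q"
    using assms(3) by (intro card_sym_diff_le_walk_length) (auto simp: p)
  moreover have "hd ?q = hd p" "last ?q = last p"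
    by (cases xs; simp add: p) (cases zs; simp add: p)
  ultimately show False
    using assms(4) by (simp add: p)
qed

lemma finite_of_cube: "set p \<subseteq> Pow {1..n::nat} \<Longrightarrow> \<forall>A\<in>set p. finite A"
  by (meson PowD finite_atLeastAtMost finite_subset subsetD)

text \<open>No walk is shorter than the Hamming distance and some path attains it, so being shortest
  means having exactly that length.\<close>

lemma shortest_path_hypercube_iff:
  assumes "A \<subseteq> {1..n}" "B \<subseteq> {1..n}"
  shows "shortest_path (hypercube n) A p B \<longleftrightarrow>
    p \<noteq> [] \<and> hd p = A \<and> last p = B \<and> set p \<subseteq> Pow {1..n} \<and> successively cube_adj p \<and>
    length p = Suc (card (sym_diff A B))" (is "?L \<longleftrightarrow> ?R")
proof -
  have lower: "card (sym_diff A B) \<le> vwalk_length q"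
    if "vwalk q (with_proj (hypercube n))" "hd q = A" "last q = B" for q
    using that card_sym_diff_le_walk_length[of q] finite_of_cube[of q n]
    by (auto simp: vwalk_hypercube_iff)
  have path: "vpath q (with_proj (hypercube n))"
    if "q \<noteq> []" "set q \<subseteq> Pow {1..n}" "successively cube_adj q"
      "length q = Suc (card (sym_diff (hd q) (last q)))" for q
    using that distinct_walk_of_dist[of q] finite_of_cube[of q n]
    by (auto simp: vpath_def vwalk_hypercube_iff)
  show ?thesis
  proof
    assume R: ?R
    then show ?L
      unfolding shortest_path_def using lower path[of p] by (auto simp: vpath_def)
  next
    assume L: ?L
    obtain q where q: "q \<noteq> []" "hd q = A" "last q = B" "set q \<subseteq> Pow {1..n}"
        "successively cube_adj q" "length q = Suc (card (sym_diff A B))"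
      using geodesic_avoiding_empty[OF assms] unfolding geodesic_avoiding_def
      by (elim exE conjE) (rule that)
    then have "vpath q (with_proj (hypercube n))"
      by (intro path) simp_all
    then have "vwalk_length p \<le> vwalk_length q"
      using L q(2,3) by (simp only: shortest_path_def)
    moreover have walk: "vwalk p (with_proj (hypercube n))" "hd p = A" "last p = B"
      using L by (auto simp: shortest_path_def vpath_def)
    moreover note lower[OF this] q(6)
    ultimately show ?R
      by (cases p) (auto simp: vwalk_hypercube_iff)
  qed
qed

section \<open>Visibility from geodesics, and its failure across a full level\<close>

lemma geodesic_avoiding_imp_visible:
  assumes "A \<subseteq> {1..n}" "B \<subseteq> {1..n}" "geodesic_avoiding n M A B"
  shows "visible (hypercube n) M A B"
proof -
  obtain p where p: "p \<noteq> []" "hd p = A" "last p = B" "set p \<subseteq> Pow {1..n}" "successively cube_adj p"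
    "length p = Suc (card (sym_diff A B))" "set (tl p) \<inter> (M - {B}) = {}"
    using assms(3) unfolding geodesic_avoiding_def by (elim exE conjE) (rule that)
  have "set p = insert A (set (tl p))"
    using p(1,2) by (cases p) auto
  then have "set p \<inter> (M - {A, B}) = {}"
    using p(7) by auto
  then show ?thesis
    unfolding visible_def shortest_path_hypercube_iff[OF assms(1,2)] using p(1-6)
    by (intro exI[of _ p] conjI)
qed

lemma visible_hypercube_sym:
  assumes "A \<subseteq> {1..n}" "B \<subseteq> {1..n}" "visible (hypercube n) M A B"
  shows "visible (hypercube n) M B A"
proof -
  obtain p where p: "p \<noteq> []" "hd p = A" "last p = B" "set p \<subseteq> Pow {1..n}" "successively cube_adj p"
    "length p = Suc (card (sym_diff A B))" "set p \<inter> (M - {A, B}) = {}"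
    using assms unfolding visible_def shortest_path_hypercube_iff[OF assms(1,2)]
    by (elim exE conjE) (rule that)
  then show ?thesis
    unfolding visible_def shortest_path_hypercube_iff[OF assms(2,1)]
    by (intro exI[of _ "rev p"] conjI)
      (simp_all add: Un_commute hd_rev last_rev insert_commute)
qed

text \<open>Discrete intermediate value argument: one edge raises the cardinality by at most one, so
  level \<open>k\<close> cannot be skipped on the way up.\<close>

lemma successively_cube_adj_card:
  assumes "successively cube_adj p" "p \<noteq> []" "\<forall>A\<in>set p. finite A"
    and "card (hd p) \<le> k" "k \<le> card (last p)"
  shows "\<exists>X\<in>set p. card X = k"
  using assms
proof (induction p)
  case (Cons A p)
  show ?case
  proof (cases "p = [] \<or> card A = k")
    case False
    have "finite A" "finite (hd p)" "cube_adj A (hd p)"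
      using Cons.prems False by (auto simp: successively_Cons)
    moreover have "hd p \<subseteq> A \<union> sym_diff A (hd p)"
      by auto
    ultimately have "card (hd p) \<le> Suc (card A)"
      using card_mono[of "A \<union> sym_diff A (hd p)" "hd p"] card_Un_le[of A "sym_diff A (hd p)"]
      by auto
    then have "\<exists>X\<in>set p. card X = k"
      using Cons.prems False by (intro Cons.IH) (auto simp: successively_Cons)
    then show ?thesis
      by simp
  qed (use Cons.prems in auto)
qed simp

text \<open>A geodesic must meet level \<open>k\<close>, and equality in the triangle inequality
  forces the meeting point to lie between \<open>A\<close> and \<open>B\<close>, where
  \<open>M\<close> fills the whole level.\<close>

lemma not_visible_across_level:
  assumes "A \<subseteq> B" "B \<subseteq> {1..n}" "card A < k" "k < card B"
    and M: "\<And>X. A \<subseteq> X \<Longrightarrow> X \<subseteq> B \<Longrightarrow> card X = k \<Longrightarrow> X \<in> M"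
  shows "\<not> visible (hypercube n) M A B"
proof
  assume "visible (hypercube n) M A B"
  then obtain p where p: "p \<noteq> []" "hd p = A" "last p = B" "set p \<subseteq> Pow {1..n}"
    "successively cube_adj p" "length p = Suc (card (sym_diff A B))" "set p \<inter> (M - {A, B}) = {}"
    unfolding visible_def shortest_path_hypercube_iff[OF subset_trans[OF assms(1,2)] assms(2)]
    by (elim exE conjE) (rule that)
  note fin = finite_of_cube[OF p(4)]
  obtain X where X: "X \<in> set p" "card X = k"
    using successively_cube_adj_card[of p k] p fin assms(3,4) by auto
  then obtain xs ys where split: "p = xs @ X # ys"
    by (meson split_list)
  have "card (sym_diff (hd (xs @ [X])) (last (xs @ [X]))) < length (xs @ [X])"
    using p(5) fin by (intro card_sym_diff_le_walk_length)
      (auto simp: split successively_append_iff)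
  moreover have "card (sym_diff (hd (X # ys)) (last (X # ys))) < length (X # ys)"
    using p(5) fin by (intro card_sym_diff_le_walk_length)
      (auto simp: split successively_append_iff)
  moreover have "hd (xs @ [X]) = A" "last (X # ys) = B"
    using p(2,3) by (cases xs; simp add: split)+
  ultimately have le: "card (sym_diff A X) + card (sym_diff X B) \<le> card (sym_diff A B)"
    using p(6) split by simp
  have finite: "finite A" "finite B" "finite X"
    using X(1) fin finite_cube_vertex[OF assms(2)] finite_subset[OF assms(1)] by auto
  \<comment> \<open>By \<open>le\<close> the triangle inequality is tight, so the two differences
    are disjoint. Since \<open>A \<subseteq> B\<close>, an element of \<open>A - X\<close> or of
    \<open>X - B\<close> would lie in both.\<close>
  have "card (sym_diff A X \<union> sym_diff X B) + card (sym_diff A X \<inter> sym_diff X B) =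
      card (sym_diff A X) + card (sym_diff X B)"
    using finite by (intro card_Un_Int[symmetric]) auto
  moreover have "card (sym_diff A B) \<le> card (sym_diff A X \<union> sym_diff X B)"
    by (rule card_mono) (use finite in auto)
  ultimately have "card (sym_diff A X \<inter> sym_diff X B) = 0"
    using le by linarith
  then have "sym_diff A X \<inter> sym_diff X B = {}"
    using finite by simp
  then have "A \<subseteq> X" "X \<subseteq> B"
    using assms(1) by blast+
  then have "X \<in> M"
    using M X by blast
  then show False
    using p(7) X assms(3,4) by auto
qed

section \<open>Lower bound\<close>

text \<open>Induction on \<open>t\<close>: one Ramsey step makes the sets of size \<open>t\<close>
  monochromatic on a subset of size \<open>N\<close>, large enough for the induction hypothesis to
  treat the smaller sizes inside it.\<close>

lemma ramsey_levels:
  "\<exists>N. \<forall>V (c :: 'a set \<Rightarrow> nat). finite V \<longrightarrow> N \<le> card V \<longrightarrow> (\<forall>X\<subseteq>V. c X < q) \<longrightarrow>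
     (\<exists>S\<subseteq>V. card S = m \<and>
       (\<forall>X\<subseteq>S. \<forall>Y\<subseteq>S. card X = card Y \<longrightarrow> card Y < t \<longrightarrow> c X = c Y))"
proof (induction t)
  case 0
  show ?case
  proof (intro exI[of _ m] allI impI)
    fix V :: "'a set" and c :: "'a set \<Rightarrow> nat"
    assume "m \<le> card V"
    then obtain S where "S \<subseteq> V" "card S = m"
      by (meson obtain_subset_with_card_n)
    then show "\<exists>S\<subseteq>V. card S = m \<and>
       (\<forall>X\<subseteq>S. \<forall>Y\<subseteq>S. card X = card Y \<longrightarrow> card Y < 0 \<longrightarrow> c X = c Y)"
      by auto
  qed
next
  case (Suc t)
  then obtain N where N: "\<forall>V (c :: 'a set \<Rightarrow> nat). finite V \<longrightarrow> N \<le> card V \<longrightarrow> (\<forall>X\<subseteq>V. c X < q) \<longrightarrow>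
     (\<exists>S\<subseteq>V. card S = m \<and>
       (\<forall>X\<subseteq>S. \<forall>Y\<subseteq>S. card X = card Y \<longrightarrow> card Y < t \<longrightarrow> c X = c Y))"
    by (elim exE) (rule that)
  \<comment> \<open>Every colour gets the same target \<open>N\<close>, so a set of that size
    results whichever colour wins.\<close>
  obtain N' :: nat where N': "partn_lst {..<N'} (replicate q N) t"
    using ramsey_full by blast
  show ?case
  proof (intro exI[of _ N'] allI impI)
    fix V :: "'a set" and c :: "'a set \<Rightarrow> nat"
    assume V: "finite V" "N' \<le> card V" and c: "\<forall>X\<subseteq>V. c X < q"
    \<comment> \<open>Ramsey's theorem is applied on \<open>{..<N'}\<close>; the injection
      \<open>h\<close> carries the outcome into \<open>V\<close>.\<close>
    obtain h where h: "inj_on h {..<N'}" "h ` {..<N'} \<subseteq> V"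
      using card_le_inj[of "{..<N'}" V] V by auto
    have "(\<lambda>X. c (h ` X)) \<in> nsets {..<N'} t \<rightarrow> {..<q}"
      using h(2) c by (auto simp: nsets_def intro!: c[rule_format])
    then obtain i where "monochromatic {..<N'} (replicate q N ! i) t (\<lambda>X. c (h ` X)) i" "i < q"
      using N' unfolding partn_lst_def by fastforce
    then obtain H where H: "H \<subseteq> {..<N'}" "card H = N" "finite H"
      and i: "\<And>X. X \<subseteq> H \<Longrightarrow> finite X \<Longrightarrow> card X = t \<Longrightarrow> c (h ` X) = i"
      unfolding monochromatic_def nsets_def by (auto simp: subset_iff image_iff)
    have inj: "inj_on h H"
      using h(1) H(1) inj_on_subset by blast
    have sub: "h ` H \<subseteq> V"
      using h(2) H(1) by blast
    have "\<exists>S\<subseteq>h ` H. card S = m \<and>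
       (\<forall>X\<subseteq>S. \<forall>Y\<subseteq>S. card X = card Y \<longrightarrow> card Y < t \<longrightarrow> c X = c Y)"
      using H sub c by (intro N[rule_format]) (auto simp: card_image[OF inj])
    then obtain S where S: "S \<subseteq> h ` H" "card S = m"
      and low: "\<forall>X\<subseteq>S. \<forall>Y\<subseteq>S. card X = card Y \<longrightarrow> card Y < t \<longrightarrow> c X = c Y"
      by (elim exE conjE) (rule that)
    have top: "c X = i" if "X \<subseteq> S" "card X = t" for X
    proof -
      have "X \<subseteq> h ` H"
        using that(1) S(1) by (rule subset_trans)
      then obtain X' where X': "X' \<subseteq> H" "X = h ` X'"
        by (rule subset_imageE)
      have "card X' = t"
        using that(2) card_image[OF inj_on_subset[OF inj X'(1)]] X'(2) by simp
      then show ?thesis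
        unfolding X'(2) using X'(1) finite_subset[OF X'(1) H(3)] by (intro i)
    qed
    have eq: "c X = c Y" if "X \<subseteq> S" "Y \<subseteq> S" "card X = card Y" "card Y < Suc t" for X Y
    proof (cases "card Y = t")
      case True
      then show ?thesis
        using that top[of X] top[of Y] by simp
    next
      case False
      then show ?thesis
        using that by (intro low[rule_format]) simp_all
    qed
    show "\<exists>S\<subseteq>V. card S = m \<and>
       (\<forall>X\<subseteq>S. \<forall>Y\<subseteq>S. card X = card Y \<longrightarrow> card Y < Suc t \<longrightarrow> c X = c Y)"
    proof (intro exI[of _ S] conjI allI impI)
      show "S \<subseteq> V"
        using S(1) sub by (rule subset_trans)
      show "card S = m"
        by (rule S(2))
      show "c X = c Y" if "X \<subseteq> S" "Y \<subseteq> S" "card X = card Y" "card Y < Suc t" for X Y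
        using that by (rule eq)
    qed
  qed
qed

text \<open>Pigeonhole: \<open>2 * q + 1\<close> arguments, \<open>q\<close> values. A class with
  more than two elements has one strictly between its minimum and its maximum.\<close>

lemma three_equal_values:
  fixes d :: "nat \<Rightarrow> nat"
  assumes "\<And>l. l \<le> 2 * q \<Longrightarrow> d l < q"
  obtains i k j where "i < k" "k < j" "j \<le> 2 * q" "d i = d k" "d k = d j"
proof -
  define L where "L y = {l. l \<le> 2 * q \<and> d l = y}" for y
  have fin: "finite (L y)" for y
    unfolding L_def by auto
  have "\<exists>y<q. card (L y) > 2"
  proof (rule ccontr)
    assume "\<not> (\<exists>y<q. card (L y) > 2)"
    then have "card (\<Union>y<q. L y) \<le> (\<Sum>y<q. 2)"
      by (intro order_trans[OF card_UN_le] sum_mono) auto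
    moreover have "(\<Union>y<q. L y) = {..2 * q}"
      using assms by (auto simp: L_def)
    ultimately show False
      by simp
  qed
  then obtain y where y: "card (L y) > 2"
    by blast
  let ?i = "Min (L y)" and ?j = "Max (L y)"
  have "card {?i, ?j} \<le> 2"
    by (simp add: card_insert_if)
  then have "\<not> L y \<subseteq> {?i, ?j}"
    using y card_mono[of "{?i, ?j}" "L y"] by auto
  then obtain k where k: "k \<in> L y" "k \<noteq> ?i" "k \<noteq> ?j"
    by blast
  then have "L y \<noteq> {}"
    by auto
  then have "?i \<in> L y" "?j \<in> L y" "?i \<le> k" "k \<le> ?j"
    using k fin[of y] Min_in[of "L y"] Max_in[of "L y"] by auto
  then show ?thesis
    using k that[of ?i k ?j] by (auto simp: L_def)
qed

lemma no_mutual_visibility_coloring: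
  "\<exists>N. \<forall>n\<ge>N. \<forall>k\<le>q. \<not> (\<exists>c. mutual_visibility_coloring (hypercube n) k c)"
proof -
  \<comment> \<open>The bound \<open>Suc (2 * q)\<close> includes \<open>S\<close> itself, so that
    all \<open>2 * q + 1\<close> sizes are available for the pigeonhole.\<close>
  obtain N where N: "\<forall>V (c :: nat set \<Rightarrow> nat). finite V \<longrightarrow> N \<le> card V \<longrightarrow> (\<forall>X\<subseteq>V. c X < q) \<longrightarrow>
     (\<exists>S\<subseteq>V. card S = 2 * q \<and>
       (\<forall>X\<subseteq>S. \<forall>Y\<subseteq>S. card X = card Y \<longrightarrow> card Y < Suc (2 * q) \<longrightarrow> c X = c Y))"
    using ramsey_levels[of q "2 * q" "Suc (2 * q)", where 'a = nat] by (elim exE) (rule that)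
  have none: "\<not> mutual_visibility_coloring (hypercube n) k c" if "N \<le> n" "k \<le> q" for n k c
  proof
    assume c: "mutual_visibility_coloring (hypercube n) k c"
    have verts: "pverts (hypercube n) = Pow {1..n}"
      by (simp add: hypercube_def)
    have col: "c X < q" if "X \<subseteq> {1..n}" for X
    proof -
      have "c X < k"
        using c that by (simp add: mutual_visibility_coloring_def verts)
      then show ?thesis
        using \<open>k \<le> q\<close> by simp
    qed
    have "\<exists>S\<subseteq>{1..n}. card S = 2 * q \<and>
        (\<forall>X\<subseteq>S. \<forall>Y\<subseteq>S. card X = card Y \<longrightarrow> card Y < Suc (2 * q) \<longrightarrow> c X = c Y)"
      using \<open>N \<le> n\<close> col by (intro N[rule_format]) auto
    then obtain S where S: "S \<subseteq> {1..n}" "card S = 2 * q"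
      and hom: "\<forall>X\<subseteq>S. \<forall>Y\<subseteq>S. card X = card Y \<longrightarrow> card Y < Suc (2 * q) \<longrightarrow> c X = c Y"
      by (elim exE conjE) (rule that)
    have "\<exists>X\<subseteq>S. card X = l" if "l \<le> 2 * q" for l
      using that S(2) by (metis obtain_subset_with_card_n)
    then obtain T where T: "\<And>l. l \<le> 2 * q \<Longrightarrow> T l \<subseteq> S \<and> card (T l) = l"
      by metis
    have "c (T l) < q" if "l \<le> 2 * q" for l
      using T[OF that] S(1) by (intro col) blast
    then obtain a b d where abd: "a < b" "b < d" "d \<le> 2 * q" "c (T a) = c (T b)" "c (T b) = c (T d)"
      using three_equal_values[of q "\<lambda>l. c (T l)"] by blast
    let ?B = "T d"
    have B: "?B \<subseteq> S" "card ?B = d"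
      using T abd by auto
    \<comment> \<open>\<open>T a\<close> need not lie inside \<open>T d\<close>, so a fresh subset
      of that size is taken; homogeneity gives it the same colour.\<close>
    obtain A where A: "A \<subseteq> ?B" "card A = a"
      using obtain_subset_with_card_n[of a ?B] B abd by auto
    let ?M = "{v \<in> pverts (hypercube n). c v = c (T b)}"
    have level: "X \<in> ?M" if "X \<subseteq> ?B" "card X \<in> {a, b, d}" for X
    proof -
      have "c X = c (T (card X))"
        using that T[of "card X"] B abd by (intro hom[rule_format]) auto
      then show ?thesis
        using that abd B S(1) by (auto simp: verts)
    qed
    have "c (T b) < k"
    proof -
      have "T b \<in> pverts (hypercube n)"
        unfolding verts using T[of b] abd S(1) by auto
      then show ?thesis
        using c by (simp add: mutual_visibility_coloring_def)
    qed
    then have "mutual_visibility_set (hypercube n) ?M"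
      using c unfolding mutual_visibility_coloring_def by blast
    moreover have "A \<in> ?M" "?B \<in> ?M"
      using level[of A] level[of ?B] A B by auto
    ultimately have "visible (hypercube n) ?M A ?B"
      unfolding mutual_visibility_set_def by blast
    moreover have "\<not> visible (hypercube n) ?M A ?B"
    proof (rule not_visible_across_level[where k = b])
      show "X \<in> ?M" if "X \<subseteq> ?B" "card X = b" for X
        using that by (intro level) simp_all
      show "?B \<subseteq> {1..n}"
        using B(1) S(1) by (rule subset_trans)
    qed (use A B abd in simp_all)
    ultimately show False
      by blast
  qed
  show ?thesis
    by (intro exI[of _ N] allI impI) (simp add: none)
qed

section \<open>A two-colouring without monochromatic blocks\<close>

text \<open>Union bound over all \<open>S\<close>: an edge with at least \<open>N\<close> elements
  is contained in, or disjoint from, at most \<open>2 * 2 ^ (card V - N)\<close> of the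
  \<open>2 ^ card V\<close> sets \<open>S\<close>.\<close>

lemma property_B:
  assumes "finite V" "finite F" "\<And>E. E \<in> F \<Longrightarrow> E \<subseteq> V" "\<And>E. E \<in> F \<Longrightarrow> N \<le> card E"
    and "2 * card F < 2 ^ N"
  obtains S where "S \<subseteq> V" "\<And>E. E \<in> F \<Longrightarrow> \<not> E \<subseteq> S" "\<And>E. E \<in> F \<Longrightarrow> E \<inter> S \<noteq> {}"
proof (cases "F = {}")
  case True
  then show ?thesis
    using that[of "{}"] by simp
next
  case False
  define mono where "mono E = {S \<in> Pow V. E \<subseteq> S \<or> E \<inter> S = {}}" for E
  have card_mono_le: "card (mono E) \<le> 2 * 2 ^ (card V - N)" if "E \<in> F" for E
  proof -
    have E: "E \<subseteq> V" "finite E" "N \<le> card E"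
      using assms(1,3,4) that by (auto intro: finite_subset)
    have "mono E \<subseteq> Pow (V - E) \<union> (\<union>) E ` Pow (V - E)"
    proof
      fix S assume S: "S \<in> mono E"
      show "S \<in> Pow (V - E) \<union> (\<union>) E ` Pow (V - E)"
      proof (cases "E \<subseteq> S")
        case True
        then have "S = E \<union> (S - E)" "S - E \<in> Pow (V - E)"
          using S by (auto simp: mono_def)
        then show ?thesis
          by blast
      qed (use S in \<open>auto simp: mono_def\<close>)
    qed
    then have "card (mono E) \<le> card (Pow (V - E)) + card ((\<union>) E ` Pow (V - E))"
      using assms(1) card_mono[of "Pow (V - E) \<union> (\<union>) E ` Pow (V - E)" "mono E"]
        card_Un_le[of "Pow (V - E)" "(\<union>) E ` Pow (V - E)"] by simp
    also have "\<dots> \<le> 2 * card (Pow (V - E))"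
      using card_image_le[of "Pow (V - E)" "(\<union>) E"] assms(1) by simp
    also have "\<dots> \<le> 2 * 2 ^ (card V - N)"
      using E assms(1) by (simp add: card_Pow card_Diff_subset)
    finally show ?thesis .
  qed
  have "N \<le> card V"
    using False assms(1,3,4) card_mono[OF assms(1)] by (meson all_not_in_conv le_trans)
  have "card (\<Union>E\<in>F. mono E) \<le> (\<Sum>E\<in>F. 2 * 2 ^ (card V - N))"
    using assms(2) card_mono_le by (intro order_trans[OF card_UN_le] sum_mono) auto
  also have "\<dots> = (2 * card F) * 2 ^ (card V - N)"
    by simp
  also have "\<dots> < 2 ^ N * 2 ^ (card V - N)"
    using assms(5) by (intro mult_strict_right_mono) auto
  also have "\<dots> = card (Pow V)"
    using \<open>N \<le> card V\<close> assms(1) by (simp add: card_Pow flip: power_add)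
  finally have "\<not> Pow V \<subseteq> (\<Union>E\<in>F. mono E)"
    using card_mono[of "\<Union>E\<in>F. mono E" "Pow V"] assms(1,2) by (auto simp: mono_def)
  then obtain S where "S \<subseteq> V" "\<And>E. E \<in> F \<Longrightarrow> S \<notin> mono E"
    by blast
  then show ?thesis
    using that[of S] by (auto simp: mono_def)
qed

section \<open>Power sums as a separating invariant of small sets\<close>

definition power_sums :: "nat \<Rightarrow> nat set \<Rightarrow> nat \<Rightarrow> nat" where
  "power_sums m A = (\<lambda>i\<in>{..<m}. \<Sum>a\<in>A. a ^ i)"

text \<open>The sum of a polynomial over a set is a linear combination of power sums with exponents
  up to the degree.\<close>

lemma sum_poly_eq_of_power_sums_eq:
  fixes p :: "int poly"
  assumes "power_sums m A = power_sums m B" "degree p < m"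
  shows "(\<Sum>a\<in>A. poly p (int a)) = (\<Sum>b\<in>B. poly p (int b))"
proof -
  have "(\<Sum>a\<in>A. int a ^ i) = (\<Sum>b\<in>B. int b ^ i)" if "i \<le> degree p" for i
    using fun_cong[OF assms(1), of i] assms(2) that
    by (simp add: power_sums_def flip: of_nat_power of_nat_sum)
  then have "(\<Sum>i\<le>degree p. coeff p i * (\<Sum>a\<in>A. int a ^ i)) =
      (\<Sum>i\<le>degree p. coeff p i * (\<Sum>b\<in>B. int b ^ i))"
    by simp
  then show ?thesis
    unfolding poly_altdef sum_distrib_left
    by (subst (1 2) sum.swap)
qed

lemma power_sums_inj:
  assumes "finite A" "finite B" "card A = card B" "2 * card B < m"
    and "power_sums m A = power_sums m B"
  shows "A = B"
proof -
  \<comment> \<open>\<open>p\<close> vanishes exactly on \<open>B\<close> and is nonnegative, so its sum over \<open>A\<close> detects elements outside \<open>B\<close>.\<close>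
  define p :: "int poly" where "p = (\<Prod>b\<in>B. [:- int b, 1:] ^ 2)"
  \<comment> \<open>Squaring the factors doubles the degree bound to \<open>2 * card B\<close>,
    which is why \<open>m\<close> has to exceed that number.\<close>
  have "degree p \<le> (\<Sum>b\<in>B. degree ([:- int b, 1:] ^ 2))"
    unfolding p_def using degree_prod_sum_le[OF assms(2)] by (simp add: comp_def)
  also have "\<dots> = 2 * card B"
    by (simp add: degree_power_eq)
  finally have "(\<Sum>a\<in>A. poly p (int a)) = (\<Sum>b\<in>B. poly p (int b))"
    using assms(4,5) by (intro sum_poly_eq_of_power_sums_eq) auto
  also have "\<dots> = 0"
    using assms(2) by (intro sum.neutral) (auto simp: p_def poly_prod prod_zero_iff)
  finally have "\<forall>a\<in>A. poly p (int a) = 0"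
    using assms(1) by (subst (asm) sum_nonneg_eq_0_iff)
      (auto simp: p_def poly_prod intro!: prod_nonneg)
  then have "A \<subseteq> B"
    using assms(2) by (auto simp: p_def poly_prod prod_zero_iff)
  then show ?thesis
    using assms(2,3) card_subset_eq by blast
qed

lemma power_sums_Un_disjoint:
  "finite X \<Longrightarrow> finite R \<Longrightarrow> X \<inter> R = {} \<Longrightarrow>
     power_sums m (X \<union> R) = (\<lambda>i\<in>{..<m}. power_sums m X i + power_sums m R i)"
  by (auto simp: power_sums_def sum.union_disjoint)

text \<open>The restriction in \<open>power_sums\<close> makes the vector extensional, so it falls
  in a finite box whose size is polynomial in \<open>n\<close> for fixed \<open>m\<close>.\<close>

lemma power_sums_in_PiE:
  assumes "A \<subseteq> {1..n}"
  shows "power_sums m A \<in> {..<m} \<rightarrow>\<^sub>E {..n ^ m}"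
proof -
  have "(\<Sum>a\<in>A. a ^ i) \<le> n ^ m" if "i < m" for i
  proof -
    have "(\<Sum>a\<in>A. a ^ i) \<le> of_nat (card A) * n ^ i"
      using assms by (intro sum_bounded_above power_mono) auto
    also have "\<dots> \<le> n * n ^ i"
      using card_mono[OF _ assms] by simp
    also have "\<dots> \<le> n ^ m"
      using that by (cases "n = 0") (auto simp flip: power_Suc intro!: power_increasing)
    finally show ?thesis .
  qed
  then show ?thesis
    by (auto simp: power_sums_def)
qed

text \<open>\<open>f\<close> is membership of the power-sum vector in the set \<open>S\<close> from
  \<open>property_B\<close>. The hypothesis is its counting condition:
  \<open>(n ^ m + 1) ^ m\<close> vectors times at most \<open>n ^ m\<close> sets \<open>D\<close>
  bound the number of traces, each of size \<open>(2 * k + 1) choose k\<close>.\<close>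

lemma ex_two_coloring:
  fixes n k :: nat
  assumes "2 * ((n ^ (2 * k + 1) + 1) ^ (2 * k + 1) * n ^ (2 * k + 1)) < 2 ^ ((2 * k + 1) choose k)"
  obtains f :: "nat set \<Rightarrow> bool" where
    "\<And>X D b. X \<subseteq> {1..n} \<Longrightarrow> D \<subseteq> {1..n} - X \<Longrightarrow> card D = 2 * k + 1 \<Longrightarrow>
       \<exists>R\<subseteq>D. card R = k \<and> f (X \<union> R) \<noteq> b"
proof -
  define m where "m = 2 * k + 1"
  define V where "V = ({..<m} \<rightarrow>\<^sub>E {..n ^ m})"
  define \<D> where "\<D> = {D. D \<subseteq> {1..n} \<and> card D = m}"
  \<comment> \<open>The values of \<open>v\<close> on the sets \<open>X \<union> R\<close> depend on \<open>X\<close> only through \<open>v X\<close>.\<close>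
  define trace where
    "trace v D = (\<lambda>R i. if i < m then v i + power_sums m R i else undefined) ` {R. R \<subseteq> D \<and> card R = k}"
    for v D
  \<comment> \<open>For arbitrary \<open>v\<close> and \<open>D\<close> the trace may leave the box
    \<open>V\<close> and is dropped; the traces coming from disjoint \<open>X\<close> and
    \<open>D\<close> inside \<open>{1..n}\<close> stay in it.\<close>
  define F where "F = {E \<in> case_prod trace ` (V \<times> \<D>). E \<subseteq> V}"
  have fin: "finite V" "finite \<D>"
    by (auto simp: V_def \<D>_def intro: finite_PiE)
  have "card \<D> = n choose m"
    unfolding \<D>_def by (subst n_subsets) auto
  also have "\<dots> \<le> n ^ m"
    by (cases "m \<le> n") (auto simp: binomial_le_pow binomial_eq_0)
  finally have card_D: "card \<D> \<le> n ^ m" .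
  have card_V: "card V = (n ^ m + 1) ^ m"
    by (simp add: V_def card_PiE)
  have "card F \<le> card (case_prod trace ` (V \<times> \<D>))"
    unfolding F_def using fin by (intro card_mono) auto
  also have "\<dots> \<le> card (V \<times> \<D>)"
    using fin by (intro card_image_le) auto
  also have "\<dots> \<le> (n ^ m + 1) ^ m * n ^ m"
    using card_D card_V by (simp add: card_cartesian_product)
  finally have card_F: "2 * card F < 2 ^ (m choose k)"
    using assms unfolding m_def by linarith
  have card_trace: "card (trace v D) = m choose k" if "D \<in> \<D>" for v D
  proof -
    have D: "finite D" "card D = m"
      using that finite_subset by (auto simp: \<D>_def)
    \<comment> \<open>The translation by \<open>v\<close> cancels, and \<open>2 * k < m\<close> lets
      the power sums separate sets of size \<open>k\<close>.\<close>
    have "inj_on (\<lambda>R i. if i < m then v i + power_sums m R i else undefined) {R. R \<subseteq> D \<and> card R = k}"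
    proof (rule inj_onI)
      fix R R' assume R: "R \<in> {R. R \<subseteq> D \<and> card R = k}" "R' \<in> {R. R \<subseteq> D \<and> card R = k}"
        and eq: "(\<lambda>i. if i < m then v i + power_sums m R i else undefined) =
          (\<lambda>i. if i < m then v i + power_sums m R' i else undefined)"
      have "power_sums m R i = power_sums m R' i" for i
        using fun_cong[OF eq, of i] by (cases "i < m") (auto simp: power_sums_def)
      then have "power_sums m R = power_sums m R'"
        by blast
      moreover have "finite R" "finite R'"
        using R D finite_subset by auto
      ultimately show "R = R'"
        using R by (intro power_sums_inj[of R R' m]) (auto simp: m_def)
    qed
    then show ?thesis
      unfolding trace_def using D by (simp add: card_image n_subsets)
  qed
  obtain S where S: "\<And>E. E \<in> F \<Longrightarrow> \<not> E \<subseteq> S" "\<And>E. E \<in> F \<Longrightarrow> E \<inter> S \<noteq> {}"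
  proof (rule property_B[OF fin(1) _ _ _ card_F])
    show "finite F"
      unfolding F_def using fin by auto
  qed (use card_trace in \<open>auto simp: F_def\<close>)
  show ?thesis
  proof
    fix X D b assume X: "X \<subseteq> {1..n}" and D: "D \<subseteq> {1..n} - X" "card D = 2 * k + 1"
    have finX: "finite X" "finite D"
      by (rule finite_subset[OF X], simp, rule finite_subset[OF D(1)], simp)
    have trace_eq: "trace (power_sums m X) D = (\<lambda>R. power_sums m (X \<union> R)) ` {R. R \<subseteq> D \<and> card R = k}"
      unfolding trace_def
    proof (rule image_cong[OF refl])
      fix R assume "R \<in> {R. R \<subseteq> D \<and> card R = k}"
      then have "finite R" "X \<inter> R = {}"
        using D finX finite_subset by auto
      then show "(\<lambda>i. if i < m then power_sums m X i + power_sums m R i else undefined) =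
          power_sums m (X \<union> R)"
        using finX by (subst power_sums_Un_disjoint) (auto simp: restrict_def)
    qed
    have "trace (power_sums m X) D \<subseteq> V"
      unfolding trace_eq V_def using X D by (intro image_subsetI power_sums_in_PiE) auto
    moreover have "power_sums m X \<in> V" "D \<in> \<D>"
      unfolding V_def using power_sums_in_PiE[OF X] D by (auto simp only: \<D>_def m_def mem_Collect_eq)
    ultimately have "trace (power_sums m X) D \<in> F"
      unfolding F_def by auto
    \<comment> \<open>For \<open>b\<close> true use that the trace is not inside \<open>S\<close>,
      for \<open>b\<close> false that it meets \<open>S\<close>.\<close>
    then show "\<exists>R\<subseteq>D. card R = k \<and> (power_sums m (X \<union> R) \<in> S) \<noteq> b"
      using S[of "trace (power_sums m X) D"] unfolding trace_eq by (cases b) auto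
  qed
qed

section \<open>Shortest paths avoiding a colour class\<close>

text \<open>Otherwise \<open>r\<close> would divide \<open>d\<close>, which lies strictly between
  consecutive multiples of \<open>r\<close>. Cardinality alone thus keeps a set off the levels that
  a colour class may occupy.\<close>

lemma mod_neq_of_gap:
  fixes x d r :: nat
  assumes "t * r < d" "d < Suc t * r"
  shows "(x + d) mod r \<noteq> x mod r"
proof
  assume "(x + d) mod r = x mod r"
  then have "r dvd d"
    using mod_eq_dvd_iff_nat[of x "x + d" r] by simp
  then obtain e where "d = e * r"
    by (metis dvdE mult.commute)
  then have "t < e" "e < Suc t"
    using assms by (metis mult_less_cancel2)+
  then show False
    by simp
qed

text \<open>\<open>M\<close> stands for one colour class and \<open>r\<close> for
  \<open>k + 1\<close>, so \<open>2 * r - 1\<close> and \<open>r - 1\<close> are the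
  \<open>2 * k + 1\<close> and \<open>k\<close> of the two-colouring. \<open>r \<ge> 3\<close> keeps
  the two nearest levels on either side of a class level free of \<open>M\<close>.\<close>

context
  fixes n r s :: nat and M :: "nat set set"
  assumes r: "r \<ge> 3"
    and level: "\<And>X. X \<in> M \<Longrightarrow> card X mod r = s"
    and escape: "\<And>X D. X \<subseteq> {1..n} \<Longrightarrow> D \<subseteq> {1..n} - X \<Longrightarrow> card D = 2 * r - 1 \<Longrightarrow>
      \<exists>R\<subseteq>D. card R = r - 1 \<and> X \<union> R \<notin> M"
begin

lemma notin_of_gap_below:
  assumes "card B mod r = s" "card B = card X + d" "t * r < d" "d < Suc t * r"
  shows "X \<notin> M"
  using level[of X] mod_neq_of_gap[OF assms(3,4), of "card X"] assms(1,2) by auto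

lemma notin_of_gap_above:
  assumes "card B mod r = s" "card X = card B + d" "t * r < d" "d < Suc t * r"
  shows "X \<notin> M"
  using level[of X] mod_neq_of_gap[OF assms(3,4), of "card B"] assms(1,2) by auto

text \<open>Modulo \<open>r\<close>, \<open>card A\<close> is one more than \<open>s\<close>, and
  \<open>t\<close> levels of the class separate \<open>A\<close> from \<open>B\<close>. Each is
  crossed at a set \<open>A \<union> R\<close> outside \<open>M\<close>, and one more insertion
  restores the situation with a smaller \<open>t\<close>.\<close>

lemma climb_from_above_level:
  assumes "A \<subseteq> B" "B \<subseteq> {1..n}" "card B mod r = s" "Suc (card B) = card A + Suc t * r"
  shows "geodesic_avoiding n M A B"
  using assms(1,4)
proof (induction t arbitrary: A)
  case 0
  have "X = B \<or> X \<notin> M" if "A \<subset> X" "X \<subseteq> B" for X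
  proof (cases "X = B")
    case False
    have "card A < card X" "card X < card B"
      using that False finite_cube_vertex[OF assms(2)] finite_subset[OF that(2)]
      by (auto intro!: psubset_card_mono)
    then show ?thesis
      using 0 by (intro disjI2 notin_of_gap_below[OF assms(3), of X "card B - card X" 0]) auto
  qed simp
  then show ?case
    by (intro geodesic_avoiding_climb[OF 0(1) subset_refl assms(2)] geodesic_avoiding_refl assms(2))
next
  case (Suc t)
  have fin: "finite A" "finite B"
    using Suc.prems(1) finite_cube_vertex[OF assms(2)] finite_subset by auto
  have "card (B - A) = card B - card A"
    using Suc.prems(1) fin by (simp add: card_Diff_subset)
  \<comment> \<open>\<open>B - A\<close> has \<open>Suc (Suc t) * r - 1\<close> elements, at least
    as many as \<open>escape\<close> asks for.\<close>
  then have "2 * r - 1 \<le> card (B - A)"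
    using Suc.prems(2) by simp
  then obtain D where D: "D \<subseteq> B - A" "card D = 2 * r - 1"
    using obtain_subset_with_card_n by metis
  obtain R where R: "R \<subseteq> D" "card R = r - 1" "A \<union> R \<notin> M"
    using escape[of A D] D Suc.prems(1) assms(2) by blast
  let ?C = "A \<union> R"
  have "?C \<subseteq> B"
    using R(1) D(1) Suc.prems(1) by auto
  then have C: "?C \<subseteq> B" "finite ?C"
    using fin(2) finite_subset by auto
  have "finite R" "A \<inter> R = {}"
    using R D C(2) by auto
  then have card_C: "card ?C = card A + (r - 1)"
    using fin R(2) by (simp add: card_Un_disjoint)
  then have "card ?C < card B"
    using Suc.prems(2) r by simp
  then obtain x where x: "x \<in> B" "x \<notin> ?C"
    using C fin by (metis card_mono not_le subsetI)
  then have card_ins: "card (insert x ?C) = Suc (card ?C)"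
    using C(2) by simp
  have "geodesic_avoiding n M (insert x ?C) B"
    using Suc.prems card_C card_ins C x r by (intro Suc.IH) auto
  moreover have "insert x ?C \<notin> M"
    using card_ins card_C Suc.prems(2) r
    by (intro notin_of_gap_below[OF assms(3), of _ "Suc t * r - 1" t]) auto
  ultimately have step: "geodesic_avoiding n M ?C B"
    using x C assms(2) by (intro geodesic_avoiding_insert[of ?C n B x]) auto
  have "X = B \<or> X \<notin> M" if X: "A \<subset> X" "X \<subseteq> ?C" for X
  proof (cases "X = ?C")
    case False
    have "card A < card X" "card X < card ?C"
      using X False C(2) finite_subset[OF X(2) C(2)] by (auto intro!: psubset_card_mono)
    then show ?thesis
      using Suc.prems(2) card_C
      by (intro disjI2 notin_of_gap_below[OF assms(3), of X "card B - card X" "Suc t"]) auto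
  qed (use R(3) in simp)
  then show ?case
    by (intro geodesic_avoiding_climb[OF _ C(1) assms(2) _ step]) auto
qed

text \<open>Inserting before removing alternates between the first and second level above residue
  \<open>s\<close>; removing first would land on a level of the class. Each round shrinks
  \<open>A - B\<close>, until \<open>A\<close> is inside \<open>B\<close> and the climb takes
  over.\<close>

lemma swap_above_level:
  assumes "A \<subseteq> {1..n}" "B \<subseteq> {1..n}" "card B mod r = s"
    and "Suc (card B) = card A + Suc t * r"
  shows "geodesic_avoiding n M A B"
  using assms(1,4)
proof (induction "card (A - B)" arbitrary: A)
  case 0
  then have "A \<subseteq> B"
    using finite_cube_vertex[of A n] by auto
  then show ?case
    using 0 assms by (intro climb_from_above_level) auto
next
  case (Suc d)
  have fin: "finite A" "finite B"
    using Suc.prems assms(2) finite_cube_vertex by auto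
  obtain y where y: "y \<in> A - B"
    using Suc.hyps(2) by (metis card.empty equals0I nat.distinct(1))
  have "card A < card B"
    using Suc.prems(2) r by simp
  then obtain x where x: "x \<in> B - A"
    using fin by (metis Diff_eq_empty_iff card_mono equals0I not_le)
  let ?A1 = "insert x A" and ?A2 = "insert x A - {y}"
  have card1: "card ?A1 = Suc (card A)" and card2: "card ?A2 = card A"
    using x y fin by auto
  have "?A2 - B = (A - B) - {y}"
    using x by auto
  then have "card (?A2 - B) = d"
    using Suc.hyps(2) y fin by simp
  moreover have "?A2 \<subseteq> {1..n}"
    using x Suc.prems(1) assms(2) by auto
  ultimately have "geodesic_avoiding n M ?A2 B"
    using Suc.hyps(1)[of ?A2] Suc.prems(2) card2 by simp
  moreover have "?A2 \<notin> M"
    using card2 Suc.prems(2) r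
    by (intro notin_of_gap_below[OF assms(3), of _ "Suc t * r - 1" t]) auto
  ultimately have "geodesic_avoiding n M ?A1 B"
    using x y Suc.prems assms(2) by (intro geodesic_avoiding_remove[of ?A1 n B y]) auto
  moreover have "?A1 \<notin> M"
    using card1 Suc.prems(2) r
    by (intro notin_of_gap_below[OF assms(3), of _ "Suc t * r - 2" t]) auto
  ultimately show ?case
    using x Suc.prems assms(2) by (intro geodesic_avoiding_insert[of A n B x]) auto
qed

text \<open>Mirror image: removing first alternates between the first and second level below that of
  \<open>B\<close>, until a single insertion reaches \<open>B\<close>.\<close>

lemma swap_below_level:
  assumes "A \<subseteq> {1..n}" "B \<subseteq> {1..n}" "card B mod r = s" "card B = Suc (card A)"
  shows "geodesic_avoiding n M A B"
  using assms(1,4)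
proof (induction "card (A - B)" arbitrary: A)
  case 0
  then have AB: "A \<subseteq> B"
    using finite_cube_vertex[of A n] by auto
  have fin: "finite A" "finite B"
    using 0 assms(2) finite_cube_vertex by auto
  obtain x where x: "x \<in> B - A"
    using AB 0 by (metis Diff_eq_empty_iff equals0I n_not_Suc_n subset_antisym)
  then have "insert x A = B"
    using AB 0 fin by (intro card_subset_eq) auto
  then show ?case
    using x 0 assms(2) geodesic_avoiding_refl[OF assms(2)]
    by (intro geodesic_avoiding_insert[of A n B x]) auto
next
  case (Suc d)
  have fin: "finite A" "finite B"
    using Suc.prems assms(2) finite_cube_vertex by auto
  obtain y where y: "y \<in> A - B"
    using Suc.hyps(2) by (metis card.empty equals0I nat.distinct(1))
  obtain x where x: "x \<in> B - A"
    using fin Suc.prems(2) by (metis Diff_eq_empty_iff card_mono equals0I not_less_eq_eq order_refl)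
  let ?A1 = "A - {y}" and ?A2 = "insert x (A - {y})"
  have "A \<noteq> {}"
    using y by auto
  then have card1: "Suc (card ?A1) = card A" and card2: "card ?A2 = card A"
    using x y fin by (auto simp: card_gt_0_iff)
  have "?A2 - B = (A - B) - {y}"
    using x by auto
  then have "card (?A2 - B) = d"
    using Suc.hyps(2) y fin by simp
  moreover have "?A2 \<subseteq> {1..n}"
    using x Suc.prems(1) assms(2) by auto
  ultimately have "geodesic_avoiding n M ?A2 B"
    using Suc.hyps(1)[of ?A2] Suc.prems(2) card2 by simp
  moreover have "?A2 \<notin> M"
    using card2 Suc.prems(2) r by (intro notin_of_gap_below[OF assms(3), of _ 1 0]) auto
  ultimately have "geodesic_avoiding n M ?A1 B"
    using x y Suc.prems assms(2) by (intro geodesic_avoiding_insert[of ?A1 n B x]) auto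
  moreover have "?A1 \<notin> M"
    using card1 Suc.prems(2) r by (intro notin_of_gap_below[OF assms(3), of _ 2 0]) auto
  ultimately show ?case
    using y Suc.prems assms(2) by (intro geodesic_avoiding_remove[of A n B y]) auto
qed

text \<open>One step leaves the level of \<open>A\<close>, downwards if the sizes agree and upwards
  otherwise, so that the matching swap lemma applies.\<close>

lemma geodesic_avoiding_same_class:
  assumes "A \<subseteq> {1..n}" "B \<subseteq> {1..n}" "card A mod r = s" "card B mod r = s" "card A \<le> card B"
  shows "geodesic_avoiding n M A B"
proof -
  have fin: "finite A" "finite B"
    using assms finite_cube_vertex by auto
  obtain t where t: "card B = card A + t * r"
    using assms mod_eq_dvd_iff_nat[of "card A" "card B" r]
    by (metis dvdE le_add_diff_inverse mult.commute)
  show ?thesis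
  proof (cases t)
    case 0
    show ?thesis
    proof (cases "A = B")
      case True
      then show ?thesis
        using geodesic_avoiding_refl assms by simp
    next
      case False
      obtain y where y: "y \<in> A - B"
        using False fin t 0 by (metis Diff_eq_empty_iff add.right_neutral card_subset_eq equals0I mult_0)
      then have card: "card B = Suc (card (A - {y}))"
        using fin t 0 by (metis DiffD1 add.right_neutral card.remove mult_0)
      then have "A - {y} \<notin> M"
        using r by (intro notin_of_gap_below[OF assms(4), of _ 1 0]) auto
      then show ?thesis
        using y assms card
        by (intro geodesic_avoiding_remove[of A n B y] swap_below_level) auto
    qed
  next
    case (Suc t')
    then have "card A < card B"
      using t r by simp
    then obtain x where x: "x \<in> B - A"
      using fin by (metis Diff_eq_empty_iff card_mono equals0I not_le)
    then have card: "card (insert x A) = Suc (card A)"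
      using fin by simp
    then have "insert x A \<notin> M"
      using r by (intro notin_of_gap_above[OF assms(3), of _ 1 0]) auto
    moreover have "geodesic_avoiding n M (insert x A) B"
      using x card t Suc assms by (intro swap_above_level[of _ _ t']) auto
    ultimately show ?thesis
      using x assms by (intro geodesic_avoiding_insert[of A n B x]) auto
  qed
qed

lemma visible_same_class:
  assumes "A \<in> M" "B \<in> M" "A \<subseteq> {1..n}" "B \<subseteq> {1..n}"
  shows "visible (hypercube n) M A B"
proof (cases "card A \<le> card B")
  case True
  then show ?thesis
    using assms level by (intro geodesic_avoiding_imp_visible geodesic_avoiding_same_class) auto
next
  case False
  then show ?thesis
    using assms level
    by (intro visible_hypercube_sym[of B n A] geodesic_avoiding_imp_visible
        geodesic_avoiding_same_class) auto
qed

end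

section \<open>Upper bound\<close>

lemma chromatic_mutual_visibility_number_hypercube_le:
  assumes "k \<ge> 2"
    and "2 * ((n ^ (2 * k + 1) + 1) ^ (2 * k + 1) * n ^ (2 * k + 1)) < 2 ^ ((2 * k + 1) choose k)"
  shows "chromatic_mutual_visibility_number (hypercube n) \<le> 2 * Suc k"
proof -
  obtain f :: "nat set \<Rightarrow> bool" where
    f: "\<And>X D b. X \<subseteq> {1..n} \<Longrightarrow> D \<subseteq> {1..n} - X \<Longrightarrow> card D = 2 * k + 1 \<Longrightarrow>
       \<exists>R\<subseteq>D. card R = k \<and> f (X \<union> R) \<noteq> b"
    using ex_two_coloring[OF assms(2)] by metis
  \<comment> \<open>The pair of a residue and a bit becomes one number, decoded by
    \<open>div 2\<close> and parity.\<close>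
  define c where "c A = 2 * (card A mod Suc k) + of_bool (f A)" for A
  have c_lt: "c A < 2 * Suc k" for A
  proof -
    have bound: "2 * a + b < 2 * Suc k" if "a < Suc k" "b \<le> 1" for a b :: nat
      using that by presburger
    show ?thesis
      unfolding c_def by (rule bound) simp_all
  qed
  have colour: "card A mod Suc k = c A div 2" "f A = odd (c A)" for A
    by (auto simp: c_def)
  have verts: "pverts (hypercube n) = Pow {1..n}"
    by (simp add: hypercube_def)
  have "mutual_visibility_set (hypercube n) {v \<in> pverts (hypercube n). c v = i}" for i
    unfolding mutual_visibility_set_def verts
  proof (intro conjI ballI)
    let ?M = "{v \<in> Pow {1..n}. c v = i}"
    fix A B assume AB: "A \<in> ?M" "B \<in> ?M"
    show "visible (hypercube n) ?M A B"
    proof (rule visible_same_class[where r = "Suc k" and s = "i div 2"])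
      show "card X mod Suc k = i div 2" if "X \<in> ?M" for X
        using that colour(1) by auto
      show "\<exists>R\<subseteq>D. card R = Suc k - 1 \<and> X \<union> R \<notin> ?M"
        if D: "X \<subseteq> {1..n}" "D \<subseteq> {1..n} - X" "card D = 2 * Suc k - 1" for X D
      proof -
        obtain R where "R \<subseteq> D" "card R = k" "f (X \<union> R) \<noteq> odd i"
          using f[OF D(1,2), of "odd i"] D(3) by auto
        then show ?thesis
          using colour(2) by (intro exI[of _ R]) auto
      qed
    qed (use AB assms(1) in auto)
  qed auto
  then have "mutual_visibility_coloring (hypercube n) (2 * Suc k) c"
    using c_lt unfolding mutual_visibility_coloring_def by simp
  then show ?thesis
    unfolding chromatic_mutual_visibility_number_def by (intro Least_le) auto
qed

section \<open>Growth estimates for the union bound\<close>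

lemma two_power_le_binomial: "2 ^ k \<le> (2 * k + 1) choose k"
proof (cases "k = 0")
  case False
  have "(2 :: real) ^ k \<le> (real (2 * k + 1) / real k) ^ k"
    using False by (intro power_mono) (auto simp: field_simps)
  also have "\<dots> \<le> real ((2 * k + 1) choose k)"
    by (rule binomial_ge_n_over_k_pow_k) simp
  finally have "real (2 ^ k) \<le> real ((2 * k + 1) choose k)"
    by simp
  then show ?thesis
    by (simp only: of_nat_le_iff)
qed simp

text \<open>The summand 1 and the leading 2 are each absorbed by a factor \<open>n\<close>, the
  former inside the power; the exponents add up to
  \<open>1 + (m + 1) * m + m = (m + 1)^2\<close>.\<close>

lemma union_bound_le:
  fixes n m :: nat
  assumes "n \<ge> 2"
  shows "2 * ((n ^ m + 1) ^ m * n ^ m) \<le> n ^ (m + 1)\<^sup>2"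
proof -
  have "n ^ m + 1 \<le> n ^ m * 2"
    using assms by (simp add: Suc_le_eq)
  also have "\<dots> \<le> n ^ (m + 1)"
    using assms by simp
  finally have "(n ^ m + 1) ^ m \<le> n ^ ((m + 1) * m)"
    unfolding power_mult by (rule power_mono) simp
  then have "2 * ((n ^ m + 1) ^ m * n ^ m) \<le> n * (n ^ ((m + 1) * m) * n ^ m)"
    using assms by (intro mult_mono) auto
  also have "\<dots> = n ^ (m + 1)\<^sup>2"
    by (simp add: power2_eq_square algebra_simps flip: power_add power_Suc)
  finally show ?thesis .
qed

text \<open>The second hypothesis is the logarithm of \<open>n ^ (m + 1)^2 < 2 ^ 2 ^ k\<close> for
  \<open>m = 2 * k + 1\<close>, where \<open>(m + 1)^2 = 4 * (k + 1)^2\<close>.\<close>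

lemma union_bound_less:
  fixes n k :: nat
  assumes "n \<ge> 2" "4 * (real k + 1)\<^sup>2 * ln (real n) < 2 ^ k * ln 2"
  shows "2 * ((n ^ (2 * k + 1) + 1) ^ (2 * k + 1) * n ^ (2 * k + 1)) < 2 ^ ((2 * k + 1) choose k)"
proof -
  have "ln (real n ^ (2 * k + 1 + 1)\<^sup>2) = real ((2 * k + 1 + 1)\<^sup>2) * ln (real n)"
    by (rule ln_realpow)
  also have "\<dots> = 4 * (real k + 1)\<^sup>2 * ln (real n)"
    by (simp add: power2_eq_square algebra_simps)
  also have "\<dots> < ln (2 ^ 2 ^ k)"
    using assms(2) by (simp add: ln_realpow)
  finally have "real n ^ (2 * k + 1 + 1)\<^sup>2 < 2 ^ 2 ^ k"
    using assms(1) by (subst (asm) ln_less_cancel_iff) auto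
  then have "real (n ^ (2 * k + 1 + 1)\<^sup>2) < real (2 ^ 2 ^ k)"
    by simp
  then have "n ^ (2 * k + 1 + 1)\<^sup>2 < 2 ^ 2 ^ k"
    by (simp only: of_nat_less_iff)
  also have "(2 :: nat) ^ 2 ^ k \<le> 2 ^ ((2 * k + 1) choose k)"
    by (intro power_increasing two_power_le_binomial) simp
  finally show ?thesis
    using union_bound_le[OF assms(1), of "2 * k + 1"] by linarith
qed

lemma eventually_chromatic_le:
  "eventually (\<lambda>n. real (chromatic_mutual_visibility_number (hypercube n)) \<le> 12 * ln (ln (real n)))
     sequentially"
proof -
  have "eventually (\<lambda>n::nat. 4 * (4 * ln (ln (real n)) + 2)\<^sup>2 * ln (real n) <
      (ln (real n))\<^sup>2 / 2) sequentially"
    by real_asymp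
  moreover have "eventually (\<lambda>n::nat. ln (ln (real n)) \<ge> 1) sequentially"
    by real_asymp
  ultimately show ?thesis
    using eventually_ge_at_top[of 3]
  proof eventually_elim
    case (elim n)
    define L where "L = ln (ln (real n))"
    \<comment> \<open>With this choice \<open>2 ^ k\<close> is at least
      \<open>exp (2 * L) = (ln n)^2\<close>, which outgrows \<open>ln n\<close> times a polynomial
      in \<open>L\<close>.\<close>
    define k where "k = nat \<lceil>4 * L\<rceil>"
    have L: "L \<ge> 1"
      using elim(2) by (simp add: L_def)
    then have k: "4 * L \<le> real k" "real k + 1 \<le> 4 * L + 2"
      unfolding k_def by linarith+
    have "4 * (real k + 1)\<^sup>2 * ln (real n) \<le> 4 * (4 * L + 2)\<^sup>2 * ln (real n)"
      using k elim(3) by (intro mult_right_mono mult_left_mono power_mono) auto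
    also have "\<dots> < (ln (real n))\<^sup>2 / 2"
      using elim(1) by (simp add: L_def)
    also have "(ln (real n))\<^sup>2 / 2 = exp (2 * L) * (1 / 2)"
      using elim(3) by (simp add: L_def exp_double)
    also have "\<dots> \<le> 2 powr (4 * L) * ln 2"
    proof (intro mult_mono)
      show ln2: "1 / 2 \<le> ln (2 :: real)"
        using ln_le_minus_one[of "1 / 2 :: real"] by (simp add: ln_div)
      show "exp (2 * L) \<le> 2 powr (4 * L)"
        using mult_left_mono[OF ln2, of "4 * L"] L by (simp add: powr_def)
    qed auto
    also have "\<dots> \<le> 2 powr (real k) * ln 2"
      using k by (intro mult_right_mono powr_mono) auto
    also have "\<dots> = 2 ^ k * ln 2"
      by (simp add: powr_realpow)
    finally have "chromatic_mutual_visibility_number (hypercube n) \<le> 2 * Suc k"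
      using k L elim(3)
      by (intro chromatic_mutual_visibility_number_hypercube_le union_bound_less) linarith+
    then have "real (chromatic_mutual_visibility_number (hypercube n)) \<le> real (2 * Suc k)"
      by (simp only: of_nat_le_iff)
    \<comment> \<open>The constant: \<open>2 * Suc k \<le> 8 * L + 4 \<le> 12 * L\<close>, as
      \<open>L \<ge> 1\<close>.\<close>
    then show ?case
      using k L unfolding L_def[symmetric] by simp
  qed
qed

text \<open>Some colouring exists, so the \<open>LEAST\<close> is attained and cannot be one of the
  excluded numbers.\<close>

lemma eventually_chromatic_gt:
  "eventually (\<lambda>n. chromatic_mutual_visibility_number (hypercube n) > q) sequentially"
proof -
  obtain N where N: "\<forall>n\<ge>N. \<forall>k\<le>q. \<not> (\<exists>c. mutual_visibility_coloring (hypercube n) k c)"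
    using no_mutual_visibility_coloring by blast
  have "chromatic_mutual_visibility_number (hypercube n) > q" if "n \<ge> N" for n
  proof -
    have "\<exists>k c. mutual_visibility_coloring (hypercube n) k c"
      by (rule ex_mutual_visibility_coloring) (simp add: hypercube_def)
    then have "\<exists>c. mutual_visibility_coloring (hypercube n)
        (chromatic_mutual_visibility_number (hypercube n)) c"
      unfolding chromatic_mutual_visibility_number_def by (rule LeastI_ex)
    then show ?thesis
      using N that by (meson not_le)
  qed
  then show ?thesis
    by (rule eventually_sequentiallyI)
qed

theorem theorem1p5:
  shows "(\<forall>q::real. q > 0 \<longrightarrow>
            (\<exists>n0::nat. n0 > 0 \<and>
              (\<forall>n\<ge>n0. real (chromatic_mutual_visibility_number (hypercube n)) > q))) \<and>
         (\<exists>C::real. C > 0 \<and>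
            (\<exists>n1::nat. \<forall>n\<ge>n1.
              real (chromatic_mutual_visibility_number (hypercube n)) \<le> C * ln (ln (real n))))"
proof (intro conjI allI impI)
  fix q :: real
  \<comment> \<open>The real bound is rounded up to a natural number; the threshold
    \<open>Suc N\<close> used afterwards is positive.\<close>
  obtain N where N: "\<And>n. n \<ge> N \<Longrightarrow> chromatic_mutual_visibility_number (hypercube n) > nat \<lceil>q\<rceil>"
    using eventually_chromatic_gt[of "nat \<lceil>q\<rceil>"] unfolding eventually_sequentially by blast
  have "real (chromatic_mutual_visibility_number (hypercube n)) > q" if "n \<ge> Suc N" for n
    using N[of n] that by linarith
  then show "\<exists>n0::nat. n0 > 0 \<and>
      (\<forall>n\<ge>n0. real (chromatic_mutual_visibility_number (hypercube n)) > q)"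
    by blast
next
  show "\<exists>C::real. C > 0 \<and> (\<exists>n1::nat. \<forall>n\<ge>n1.
      real (chromatic_mutual_visibility_number (hypercube n)) \<le> C * ln (ln (real n)))"
    using eventually_chromatic_le unfolding eventually_sequentially
    by (intro exI[of _ 12]) simp
qed

end
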